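(* Assume that $\mathcal R$ is well defined on $\mathcal U^o\times(\mathcal S\setminus\{0\})$. Then, for every $u\in\mathcal U^o$ and every $v\in\mathcal S\setminus\{0\}$ with $\Lambda(v)<+\infty$, one has $$\lambda(u)\le\lambda^*\le\Lambda(v).$$ Equivalently, $$0\le\lambda^*-\lambda(u)\le\Lambda(v)-\lambda(u).$$ In particular, if $u_\lambda\in\mathcal U^o$ is an admissible solution of $\mathcal F(u_\lambda,\lambda)=0$, then, for every $v\in\mathcal S\setminus\{0\}$ with $\Lambda(v)<+\infty$, $$0\le\lambda^*-\lambda\le\Lambda(v)-\lambda.$$ Consequently, if $\Lambda(v)-\lambda\le\varepsilon$ for some $v\in\mathcal S\setminus\{0\}$, then $0\le\lambda^*-\lambda\le\varepsilon$.
   Context: $W$ is a reflexive Banach space with dual $W^*$ and duality pairing $\langle\cdot,\cdot\rangle$; $\mathcal C^0$ is an ordered Banach function space ($W$ and $\mathcal C^0$ are subspaces of a common vector space). $\mathcal S^o\subset W\cap\mathcal C^0$ is a convex cone, $\mathcal S:=\overline{\mathcal S^o}^{\,\mathcal C^0}\cap W$, $\overline{\operatorname{span}\mathcal S^o}^{\,W}=W$, and $\mathcal U^o\subset\mathcal S^o$ is a fixed subclass (the admissible class; an admissible solution is a solution lying in $\mathcal U^o$). $\mathcal A,\mathcal G:W\to W^*$ are maps, $\lambda\in\mathbb R$ is a parameter, $\mathcal F(u,\lambda):=\mathcal A(u)-\lambda\mathcal G(u)$, and $$\mathcal R(u,v):=\frac{\langle\mathcal A(u),v\rangle}{\langle\mathcal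 G(u),v\rangle};$$ "$\mathcal R$ is well defined on $\mathcal U^o\times(\mathcal S\setminus\{0\})$" means $\langle\mathcal G(u),v\rangle\ne0$ there. Define $$\lambda(u):=\inf_{v\in\mathcal S\setminus\{0\}}\mathcal R(u,v)\ (u\in\mathcal U^o),\quad \Lambda(v):=\sup_{u\in\mathcal U^o}\mathcal R(u,v)\ (v\in\mathcal S\setminus\{0\}),\quad \lambda^*:=\sup_{u\in\mathcal U^o}\lambda(u).$$ *)

theory Defs
  imports "HOL-Analysis.Analysis"
begin

definition reflexive_space :: "'w::banach itself \<Rightarrow> bool" where
  "reflexive_space _ \<longleftrightarrow>
     (\<forall>\<phi> :: ('w \<Rightarrow>\<^sub>L real) \<Rightarrow>\<^sub>L real. \<exists>w. \<forall>f. blinfun_apply \<phi> f = blinfun_apply f w)"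

(* ev f p is the value of f at the point p: the elements of 'c are real functions with the
   pointwise order (injectivity of ev follows from antisymmetry). The positive cone is closed,
   as usual for ordered Banach spaces. Spaces of a.e. classes are covered too: by Hahn-Banach,
   an ordered Banach space with closed positive cone is a function space, with pointwise order,
   on the set of its positive continuous functionals. *)
definition ordered_banach_function_space ::
    "('c::{banach,ordered_real_vector} \<Rightarrow> 'p \<Rightarrow> real) \<Rightarrow> bool" where
  "ordered_banach_function_space ev \<longleftrightarrow>
     (\<forall>p. linear (\<lambda>f. ev f p)) \<and>
     (\<forall>f g. f \<le> g \<longleftrightarrow> (\<forall>p. ev f p \<le> ev g p)) \<and>
     closed {f :: 'c. 0 \<le> f}"

(* Unlike with conic and convex_cone of HOL-Analysis, the cone need not contain 0, so that
   cones of strictly positive functions are allowed. *)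
definition is_convex_cone :: "'w::real_vector set \<Rightarrow> bool" where
  "is_convex_cone K \<longleftrightarrow> convex K \<and> (\<forall>c>0. \<forall>x\<in>K. c *\<^sub>R x \<in> K)"

(* The spaces W and C0 are the types 'w and 'c, realised as subspaces of a common vector space
   'x by injective linear maps iW and iC. Subsets of W that lie in C0 are represented as
   subsets K of 'w with iW ` K \<subseteq> range iC. The following is the intersection of W with the
   closure of K in the norm of C0. *)
definition C0_closure_in_W ::
    "('w::banach \<Rightarrow> 'x::real_vector) \<Rightarrow> ('c::banach \<Rightarrow> 'x) \<Rightarrow> 'w set \<Rightarrow> 'w set" where
  "C0_closure_in_W iW iC K = {w. iW w \<in> iC ` closure (iC -` (iW ` K))}"

definition FF ::
    "('w::banach \<Rightarrow> ('w \<Rightarrow>\<^sub>L real)) \<Rightarrow> ('w \<Rightarrow> ('w \<Rightarrow>\<^sub>L real)) \<Rightarrow> 'w \<Rightarrow> real \<Rightarrow> ('w \<Rightarrow>\<^sub>L real)" where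
  "FF A G u l = A u - l *\<^sub>R G u"

definition RR ::
    "('w::banach \<Rightarrow> ('w \<Rightarrow>\<^sub>L real)) \<Rightarrow> ('w \<Rightarrow> ('w \<Rightarrow>\<^sub>L real)) \<Rightarrow> 'w \<Rightarrow> 'w \<Rightarrow> real" where
  "RR A G u v = blinfun_apply (A u) v / blinfun_apply (G u) v"

definition RR_well_defined ::
    "('w::banach \<Rightarrow> ('w \<Rightarrow>\<^sub>L real)) \<Rightarrow> 'w set \<Rightarrow> 'w set \<Rightarrow> bool" where
  "RR_well_defined G U S \<longleftrightarrow> (\<forall>u\<in>U. \<forall>v\<in>S - {0}. blinfun_apply (G u) v \<noteq> 0)"

definition lam ::
    "('w::banach \<Rightarrow> ('w \<Rightarrow>\<^sub>L real)) \<Rightarrow> ('w \<Rightarrow> ('w \<Rightarrow>\<^sub>L real)) \<Rightarrow> 'w set \<Rightarrow> 'w \<Rightarrow> ereal" where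
  "lam A G S u = (INF v\<in>S - {0}. ereal (RR A G u v))"

definition Lam ::
    "('w::banach \<Rightarrow> ('w \<Rightarrow>\<^sub>L real)) \<Rightarrow> ('w \<Rightarrow> ('w \<Rightarrow>\<^sub>L real)) \<Rightarrow> 'w set \<Rightarrow> 'w \<Rightarrow> ereal" where
  "Lam A G U v = (SUP u\<in>U. ereal (RR A G u v))"

definition lam_star ::
    "('w::banach \<Rightarrow> ('w \<Rightarrow>\<^sub>L real)) \<Rightarrow> ('w \<Rightarrow> ('w \<Rightarrow>\<^sub>L real)) \<Rightarrow> 'w set \<Rightarrow> 'w set \<Rightarrow> ereal" where
  "lam_star A G U S = (SUP u\<in>U. lam A G S u)"

end

theory Submission
  imports Defs
begin

text \<open>This is the easy half of a minimax principle: for each admissible \<open>u\<close> and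
  each nonzero \<open>v\<close> in \<open>S\<close>, the value \<open>RR A G u v\<close> lies above
  the infimum over \<open>v\<close> and below the supremum over \<open>u\<close>. Hence sup inf is
  at most every value \<open>Lam A G U v\<close> (\<open>lam_star_le_Lam\<close>). A solution
  satisfies \<open>A u = l *\<^sub>R G u\<close>, so its quotient is constantly \<open>l\<close>
  (\<open>RR_solution\<close>). Thus \<open>l\<close> bounds \<open>lam\<close> at that solution
  from below (\<open>solution_le_lam\<close>), hence also \<open>lam_star\<close>, and subtracting
  \<open>l\<close> gives the error estimates.\<close>

lemma lam_le_lam_star:
  assumes "u \<in> U"
  shows "lam A G S u \<le> lam_star A G U S"
  unfolding lam_star_def using assms by (rule SUP_upper)

text \<open>Compare the two suprema term by term with the same \<open>u\<close>: the infimum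
  defining \<open>lam\<close> is at most its value at the given \<open>v\<close>.\<close>

lemma lam_star_le_Lam:
  assumes "v \<in> S - {0}"
  shows "lam_star A G U S \<le> Lam A G U v"
  unfolding lam_star_def Lam_def lam_def
  using assms by (intro SUP_mono) (blast intro: INF_lower)

text \<open>The nonzero denominator is what permits cancelling, as x / 0 = 0 in HOL.\<close>

lemma RR_solution:
  assumes "FF A G u l = 0" and "blinfun_apply (G u) v \<noteq> 0"
  shows "RR A G u v = l"
  using assms by (simp add: FF_def RR_def scaleR_blinfun.rep_eq)

text \<open>An inequality rather than an equality: if \<open>S - {0}\<close> is empty, the infimum
  is \<infinity>.\<close>

lemma solution_le_lam:
  assumes "FF A G u l = 0" and "u \<in> U" and "RR_well_defined G U S"
  shows "ereal l \<le> lam A G S u"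
  unfolding lam_def
proof (rule INF_greatest)
  fix v assume "v \<in> S - {0}"
  with assms have "RR A G u v = l"
    by (intro RR_solution) (auto simp: RR_well_defined_def)
  then show "ereal l \<le> ereal (RR A G u v)" by simp
qed

theorem corollary3p1:
  fixes iW :: "'w::banach \<Rightarrow> 'x::real_vector"
    and iC :: "'c::{banach,ordered_real_vector} \<Rightarrow> 'x"
    and ev :: "'c \<Rightarrow> 'p \<Rightarrow> real"
    and So S Uo :: "'w set"
    and A G :: "'w \<Rightarrow> ('w \<Rightarrow>\<^sub>L real)"
  assumes "reflexive_space TYPE('w)"
    and "ordered_banach_function_space ev"
    and "linear iW" and "inj iW" and "linear iC" and "inj iC"
    and "iW ` So \<subseteq> range iC"
    and "is_convex_cone So"
    and S: "S = C0_closure_in_W iW iC So"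
    and "closure (span So) = UNIV"
    and "Uo \<subseteq> So"
    and wd: "RR_well_defined G Uo S"
  shows "(\<forall>u\<in>Uo. \<forall>v\<in>S - {0}. Lam A G Uo v < \<infinity> \<longrightarrow>
            lam A G S u \<le> lam_star A G Uo S \<and> lam_star A G Uo S \<le> Lam A G Uo v) \<and>
         (\<forall>u\<in>Uo. \<forall>v\<in>S - {0}. Lam A G Uo v < \<infinity> \<longrightarrow>
            0 \<le> lam_star A G Uo S - lam A G S u \<and>
            lam_star A G Uo S - lam A G S u \<le> Lam A G Uo v - lam A G S u) \<and>
         (\<forall>l :: real. \<forall>u\<in>Uo. FF A G u l = 0 \<longrightarrow>
            (\<forall>v\<in>S - {0}. Lam A G Uo v < \<infinity> \<longrightarrow>
               0 \<le> lam_star A G Uo S - ereal l \<and>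
               lam_star A G Uo S - ereal l \<le> Lam A G Uo v - ereal l) \<and>
            (\<forall>\<epsilon> :: real. (\<exists>v\<in>S - {0}. Lam A G Uo v - ereal l \<le> ereal \<epsilon>) \<longrightarrow>
               0 \<le> lam_star A G Uo S - ereal l \<and>
               lam_star A G Uo S - ereal l \<le> ereal \<epsilon>))"
proof (intro conjI ballI allI impI)
  fix u v assume "u \<in> Uo" and v: "v \<in> S - {0}"
  show le: "lam A G S u \<le> lam_star A G Uo S" using \<open>u \<in> Uo\<close> by (rule lam_le_lam_star)
  show Le: "lam_star A G Uo S \<le> Lam A G Uo v" using v by (rule lam_star_le_Lam)
  \<comment> \<open>Infinite values do no harm: in \<open>ereal\<close> the difference of two equal
    infinities is \<infinity>.\<close>
  show "0 \<le> lam_star A G Uo S - lam A G S u" using le by (rule ereal_diff_positive)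
  show "lam_star A G Uo S - lam A G S u \<le> Lam A G Uo v - lam A G S u"
    using Le by (intro ereal_minus_mono) simp_all
next
  fix l u assume "u \<in> Uo" and "FF A G u l = 0"
  then have "ereal l \<le> lam_star A G Uo S"
    using wd by (blast intro: order_trans solution_le_lam lam_le_lam_star)
  then show "0 \<le> lam_star A G Uo S - ereal l" by (rule ereal_diff_positive)
  \<comment> \<open>The same lower bound is a goal twice: for a given \<open>v\<close>, and under
    the \<epsilon>-hypothesis.\<close>
  then show "0 \<le> lam_star A G Uo S - ereal l" .
  \<comment> \<open>Kept general in \<open>v\<close>, to be applied below to the witness of the
    \<epsilon>-bound.\<close>
  show upper: "lam_star A G Uo S - ereal l \<le> Lam A G Uo v - ereal l" if "v \<in> S - {0}" for v
    using that by (intro ereal_minus_mono lam_star_le_Lam) simp_all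
  show "lam_star A G Uo S - ereal l \<le> ereal \<epsilon>"
    if "\<exists>v\<in>S - {0}. Lam A G Uo v - ereal l \<le> ereal \<epsilon>" for \<epsilon>
    using that upper by (blast intro: order_trans)
qed

end
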